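(* Let $2\le l\le d$ and suppose the distribution of a random vector $\mathbf{Z}$ in $[0,\infty)^d$ has hidden regular variation on $\mathbb{E}^{(l)}$ with limit measure $\nu^{(l)}$, index $\alpha^{(l)}>0$ and hidden angular measure $S^{(l)}$, normalized so that $\nu^{(l)}(\{\mathbf{x}\in\mathbb{E}^{(l)}:x^{(l)}\ge1\})=1$. Let $\|\cdot\|$ be any norm. Then $\nu^{(l)}(\{\mathbf{x}\in\mathbb{E}^{(l)}:\|\mathbf{x}\|>1\})$ is finite if and only if $$\int_{\delta\aleph^{(l)}}\|\boldsymbol{\theta}\|^{\alpha^{(l)}}\,S^{(l)}(d\boldsymbol{\theta})<\infty.$$
   Context: For $\mathbf{x}\in[0,\infty]^d$, $x^{(i)}$ is the $i$-th largest component ($x^{(1)}\ge\dots\ge x^{(d)}$). $\mathbb{E}^{(l)}=\{\mathbf{x}\in[0,\infty]^d:x^{(l)}>0\}$ for $1\le l\le d$, $\aleph^{(l)}=\{\mathbf{x}\in\mathbb{E}^{(l)}:x^{(l)}\ge1\}$, $\delta\aleph^{(l)}=\{\mathbf{x}\in\mathbb{E}^{(l)}:x^{(l)}=1\}$. Convention: $\|\mathbf{x}\|=\infty$ if some component of $\mathbf{x}$ is $\infty$. Regular variation on $\mathbb{E}^{(j)}$ with scaling function $b^{(j)}(t)\uparrow\infty$ and limit measure $\nu^{(j)}$ (a non-zero Radon measure on $\mathbb{E}^{(j)}$) means $tP[\mathbf{Z}/b^{(j)}(t)\in\cdot]\stackrel{v}{\rightarrow}\nu^{(j)}(\cdot)$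 vaguely in the space of Radon measures on $\mathbb{E}^{(j)}$ as $t\to\infty$; for $j=1$ it is also required that $\nu^{(1)}$ have non-zero marginals. There is then $\alpha^{(j)}>0$ with $\nu^{(j)}(c\,\cdot)=c^{-\alpha^{(j)}}\nu^{(j)}(\cdot)$ for all $c>0$. Scaling functions are chosen so that $\nu^{(j)}(\aleph^{(j)})=1$. The distribution of $\mathbf{Z}$ has hidden regular variation (HRV) on $\mathbb{E}^{(l)}$, $2\le l\le d$, if it is regularly varying on $\mathbb{E}^{(1)}$, and for some $1\le j<l$ it is regularly varying on $\mathbb{E}^{(j)}$ with $\nu^{(j)}(\mathbb{E}^{(l-1)})>0$ and $\nu^{(j)}(\mathbb{E}^{(l)})=0$, and it is regularly varying on $\mathbb{E}^{(l)}$ with a non-decreasing scaling function $b^{(l)}$ satisfying $b^{(j)}(t)/b^{(l)}(t)\to\infty$. (In the non-standard case, $\mathbf{Z}$ is replaced throughout by $(a^{1\leftarrow}(Z^1),\dots,a^{d\leftarrow}(Z^d))$ for marginal scaling functions $a^i(t)\uparrow\infty$ with generalized inverses $a^{i\leftarrow}$, and $b^{(1)}(t)=t$.) The hidden angular measure $S^{(l)}$ is the probability measure on $\delta\aleph^{(l)}$ determined by $\nu^{(l)}(\{\mathbf{x}\in\mathbb{E}^{(l)}:x^{(l)}\ge r,\ \mathbf{x}/x^{(l)}\in\Lambda\})=r^{-\alpha^{(l)}}S^{(l)}(\Lambda)$ for all $r>0$ and Borel $\Lambda\subset\delta\aleph^{(l)}$. *)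

theory Defs
  imports "HOL-Probability.Probability" "HOL-Library.Multiset"
begin

text \<open>
  Points of \<open>[0,\<infinity>]\<^sup>d\<close> are functions \<open>'d \<Rightarrow> ennreal\<close> with the product topology, where \<open>'d\<close> is a
  finite index type and \<open>d = CARD('d)\<close>; points of \<open>\<real>\<^sup>d\<close> are elements of \<open>real ^ 'd\<close>.
\<close>

definition ord_stat :: "nat \<Rightarrow> ('d::finite \<Rightarrow> 'b::linorder) \<Rightarrow> 'b" where
  "ord_stat l x = rev (sorted_list_of_multiset (image_mset x (mset_set UNIV))) ! (l - 1)"
  \<comment> \<open>The \<open>l\<close>-th largest component, counted with multiplicity; meaningful for \<open>1 \<le> l \<le> CARD('d)\<close>.\<close>

definition ext_cone :: "nat \<Rightarrow> ('d::finite \<Rightarrow> ennreal) set" where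
  "ext_cone l = {x. ord_stat l x > 0}"

definition aleph :: "nat \<Rightarrow> ('d::finite \<Rightarrow> ennreal) set" where
  "aleph l = {x \<in> ext_cone l. ord_stat l x \<ge> 1}"

definition delta_aleph :: "nat \<Rightarrow> ('d::finite \<Rightarrow> ennreal) set" where
  "delta_aleph l = {x \<in> ext_cone l. ord_stat l x = 1}"

definition to_ext :: "real ^ 'd::finite \<Rightarrow> 'd \<Rightarrow> ennreal" where
  "to_ext x = (\<lambda>i. ennreal (x $ i))"

definition is_norm :: "('v::real_vector \<Rightarrow> real) \<Rightarrow> bool" where
  "is_norm N \<longleftrightarrow>
     (\<forall>x. N x \<ge> 0) \<and> (\<forall>x. N x = 0 \<longleftrightarrow> x = 0) \<and>
     (\<forall>c x. N (c *\<^sub>R x) = \<bar>c\<bar> * N x) \<and> (\<forall>x y. N (x + y) \<le> N x + N y)"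

definition ext_norm :: "(real ^ 'd \<Rightarrow> real) \<Rightarrow> ('d::finite \<Rightarrow> ennreal) \<Rightarrow> ennreal" where
  "ext_norm N x = (if \<exists>i. x i = \<infinity> then \<infinity> else ennreal (N (\<chi> i. enn2real (x i))))"

definition ext_powr :: "ennreal \<Rightarrow> real \<Rightarrow> ennreal" where
  "ext_powr x a = (if x = \<infinity> then \<infinity> else ennreal (enn2real x powr a))"
  \<comment> \<open>Only used with \<open>a > 0\<close>, where \<open>\<infinity>\<close> to the power \<open>a\<close> is \<open>\<infinity>\<close>.\<close>

text \<open>
  On the locally compact second countable spaces \<open>ext_cone l\<close>, a Radon measure is a Borel measure that is
  finite on compact sets. Compactness of a subset of \<open>E\<close> does not depend on whether it is taken in
  \<open>E\<close> or in the ambient space, so in \<open>ext_cone l\<close> compact sets may contain points with infinite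
  components but stay away from \<open>ord_stat l x = 0\<close>.
\<close>

definition radon_measure_on :: "'a::topological_space set \<Rightarrow> 'a measure \<Rightarrow> bool" where
  "radon_measure_on E \<nu> \<longleftrightarrow>
     sets \<nu> = sets (restrict_space borel E) \<and>
     (\<forall>K. compact K \<and> K \<subseteq> E \<longrightarrow> emeasure \<nu> K < \<infinity>)"

definition vaguely_tendsto_on ::
  "'a::topological_space set \<Rightarrow> ('t \<Rightarrow> 'a measure) \<Rightarrow> 'a measure \<Rightarrow> 't filter \<Rightarrow> bool" where
  "vaguely_tendsto_on E \<mu> \<nu> F \<longleftrightarrow>
     (\<forall>f :: 'a \<Rightarrow> real.
        continuous_on E f \<and> (\<forall>x\<in>E. 0 \<le> f x) \<and>
        (\<exists>K. compact K \<and> K \<subseteq> E \<and> (\<forall>x\<in>E - K. f x = 0)) \<longrightarrow>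
        ((\<lambda>t. \<integral>x. f x \<partial>\<mu> t) \<longlongrightarrow> (\<integral>x. f x \<partial>\<nu>)) F)"

definition increasing_to_infinity :: "(real \<Rightarrow> real) \<Rightarrow> bool" where
  "increasing_to_infinity b \<longleftrightarrow> mono_on {0<..} b \<and> filterlim b at_top at_top"

definition scaled_law ::
  "'a measure \<Rightarrow> ('a \<Rightarrow> real ^ 'd::finite) \<Rightarrow> (real \<Rightarrow> real) \<Rightarrow> ('d \<Rightarrow> ennreal) set \<Rightarrow> real
    \<Rightarrow> ('d \<Rightarrow> ennreal) measure" where
  "scaled_law M Z b E t =
     scale_measure (ennreal t)
       (restrict_space (distr M borel (\<lambda>\<omega>. to_ext (Z \<omega> /\<^sub>R b t))) E)"
  \<comment> \<open>The measure \<open>t P[Z / b(t) \<in> \<cdot>]\<close> on \<open>E\<close>.\<close>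

definition regularly_varying ::
  "'a measure \<Rightarrow> ('a \<Rightarrow> real ^ 'd::finite) \<Rightarrow> nat \<Rightarrow> (real \<Rightarrow> real) \<Rightarrow> ('d \<Rightarrow> ennreal) measure
    \<Rightarrow> bool" where
  "regularly_varying M Z j b \<nu> \<longleftrightarrow>
     increasing_to_infinity b \<and>
     radon_measure_on (ext_cone j) \<nu> \<and> emeasure \<nu> (ext_cone j) \<noteq> 0 \<and>
     (j = 1 \<longrightarrow> (\<forall>i. emeasure \<nu> {x \<in> ext_cone 1. x i > 0} \<noteq> 0)) \<and>
     vaguely_tendsto_on (ext_cone j) (scaled_law M Z b (ext_cone j)) \<nu> at_top \<and>
     emeasure \<nu> (aleph j) = 1"
  \<comment> \<open>The clause for \<open>j = 1\<close> says that no marginal of \<open>\<nu>\<close>, as a measure on \<open>(0,\<infinity>]\<close>, is zero; the last line is the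
      standing normalization of the scaling function.\<close>

definition hrv_standard ::
  "'a measure \<Rightarrow> ('a \<Rightarrow> real ^ 'd::finite) \<Rightarrow> nat \<Rightarrow> (nat \<Rightarrow> real \<Rightarrow> real)
    \<Rightarrow> (nat \<Rightarrow> ('d \<Rightarrow> ennreal) measure) \<Rightarrow> bool" where
  "hrv_standard M Z l b \<nu> \<longleftrightarrow>
     2 \<le> l \<and> l \<le> CARD('d) \<and>
     regularly_varying M Z 1 (b 1) (\<nu> 1) \<and>
     (\<exists>j. 1 \<le> j \<and> j < l \<and>
        regularly_varying M Z j (b j) (\<nu> j) \<and>
        emeasure (\<nu> j) (ext_cone (l - 1)) > 0 \<and> emeasure (\<nu> j) (ext_cone l) = 0 \<and>
        filterlim (\<lambda>t. b j t / b l t) at_top at_top) \<and>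
     regularly_varying M Z l (b l) (\<nu> l)"

definition gen_inverse :: "(real \<Rightarrow> real) \<Rightarrow> real \<Rightarrow> real" where
  "gen_inverse a s = Inf {t. t > 0 \<and> a t \<ge> s}"

definition hidden_regular_variation ::
  "'a measure \<Rightarrow> ('a \<Rightarrow> real ^ 'd::finite) \<Rightarrow> nat \<Rightarrow> (nat \<Rightarrow> real \<Rightarrow> real)
    \<Rightarrow> (nat \<Rightarrow> ('d \<Rightarrow> ennreal) measure) \<Rightarrow> bool" where
  "hidden_regular_variation M Z l b \<nu> \<longleftrightarrow>
     hrv_standard M Z l b \<nu> \<or>
     (\<exists>a :: 'd \<Rightarrow> real \<Rightarrow> real.
        (\<forall>i. increasing_to_infinity (a i)) \<and> (\<forall>t>0. b 1 t = t) \<and>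
        hrv_standard M (\<lambda>\<omega>. \<chi> i. gen_inverse (a i) (Z \<omega> $ i)) l b \<nu>)"
  \<comment> \<open>The second disjunct is the non-standard case.\<close>

definition homogeneity_index :: "('d::finite \<Rightarrow> ennreal) measure \<Rightarrow> real \<Rightarrow> bool" where
  "homogeneity_index \<nu> \<alpha> \<longleftrightarrow>
     (\<forall>c>0. \<forall>A\<in>sets \<nu>.
        emeasure \<nu> ((\<lambda>x i. ennreal c * x i) ` A) = ennreal (c powr (- \<alpha>)) * emeasure \<nu> A)"

definition hidden_angular_measure ::
  "nat \<Rightarrow> ('d::finite \<Rightarrow> ennreal) measure \<Rightarrow> real \<Rightarrow> ('d \<Rightarrow> ennreal) measure \<Rightarrow> bool" where
  "hidden_angular_measure l \<nu> \<alpha> S \<longleftrightarrow>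
     prob_space S \<and> sets S = sets (restrict_space borel (delta_aleph l)) \<and>
     (\<forall>r>0. \<forall>\<Lambda>\<in>sets S.
        emeasure \<nu> {x \<in> ext_cone l. ord_stat l x \<ge> ennreal r \<and> (\<lambda>i. x i / ord_stat l x) \<in> \<Lambda>}
          = ennreal (r powr (- \<alpha>)) * emeasure S \<Lambda>)"
  \<comment> \<open>Points with \<open>ord_stat l x = \<infinity>\<close> do not contribute: in \<open>ennreal\<close> the quotient is then the zero
      vector, which is not in \<open>delta_aleph l\<close>.\<close>

end

theory Submission
  imports Defs
begin

text \<open>
  In polar coordinates \<open>r = x\<^sup>(\<^sup>l\<^sup>)\<close>, \<open>\<theta> = x / x\<^sup>(\<^sup>l\<^sup>)\<close> homogeneity of the norm turns \<open>\<parallel>x\<parallel> > 1\<close> into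
  \<open>r f(\<theta>) > 1\<close> with \<open>f = \<parallel>\<cdot>\<parallel>\<close>. For a simple function \<open>f\<close> the defining property of \<open>S\<close> gives
  \<open>\<nu>{r f(\<theta>) > 1} = \<integral>f\<^sup>\<alpha> dS\<close> level set by level set. Because the inequality is strict, both sides are
  continuous along increasing sequences of \<open>f\<close>, so the identity holds for all measurable \<open>f\<close>; in
  particular the two quantities of the theorem are equal, not just simultaneously finite.
\<close>

section \<open>Powers of extended nonnegative reals\<close>

lemma ext_powr_ennreal: "0 \<le> x \<Longrightarrow> ext_powr (ennreal x) a = ennreal (x powr a)"
  by (simp add: ext_powr_def)

text \<open>The powers \<open>a\<close> and \<open>1 / a\<close> form a Galois connection on the
  extended half-line. Monotonicity and preservation of suprema follow formally, with no discussion
  of continuity.\<close>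

lemma ext_powr_le_iff:
  assumes "a > 0"
  shows "ext_powr x a \<le> y \<longleftrightarrow> x \<le> ext_powr y (1 / a)"
proof (cases x; cases y)
  fix p q :: real
  assume "0 \<le> p" "0 \<le> q" and xy: "x = ennreal p" "y = ennreal q"
  have "p powr a \<le> q \<longleftrightarrow> p \<le> q powr (1 / a)"
  proof
    assume "p powr a \<le> q"
    then have "(p powr a) powr (1 / a) \<le> q powr (1 / a)"
      using assms by (intro powr_mono2) auto
    then show "p \<le> q powr (1 / a)"
      using assms \<open>0 \<le> p\<close> by (simp add: powr_powr)
  next
    assume "p \<le> q powr (1 / a)"
    then have "p powr a \<le> (q powr (1 / a)) powr a"
      using assms \<open>0 \<le> p\<close> by (intro powr_mono2) auto
    then show "p powr a \<le> q"
      using assms \<open>0 \<le> q\<close> by (simp add: powr_powr)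
  qed
  with xy \<open>0 \<le> p\<close> \<open>0 \<le> q\<close> show ?thesis
    by (simp add: ext_powr_ennreal)
qed (auto simp: ext_powr_def top_unique)

text \<open>A lower adjoint preserves suprema over any index set; the upper adjoint here is the
  power \<open>1 / a\<close>.\<close>

lemma ext_powr_SUP:
  assumes "a > 0"
  shows "ext_powr (SUP i\<in>I. f i) a = (SUP i\<in>I. ext_powr (f i) a)"
proof (rule order_class.order_eq_iff[THEN iffD2], intro conjI)
  show "ext_powr (SUP i\<in>I. f i) a \<le> (SUP i\<in>I. ext_powr (f i) a)"
    unfolding ext_powr_le_iff[OF assms]
  proof (rule SUP_least)
    fix i assume "i \<in> I"
    then show "f i \<le> ext_powr (SUP i\<in>I. ext_powr (f i) a) (1 / a)"
      unfolding ext_powr_le_iff[OF assms, symmetric] by (rule SUP_upper)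
  qed
  have "ext_powr (f i) a \<le> ext_powr (SUP i\<in>I. f i) a" if "i \<in> I" for i
    unfolding ext_powr_le_iff[OF assms]
    using SUP_upper[OF that, of f] ext_powr_le_iff[OF assms, of "SUP i\<in>I. f i"]
    by (meson order.trans order_refl)
  then show "(SUP i\<in>I. ext_powr (f i) a) \<le> ext_powr (SUP i\<in>I. f i) a"
    by (rule SUP_least)
qed

lemma ext_powr_mono: "a > 0 \<Longrightarrow> x \<le> y \<Longrightarrow> ext_powr x a \<le> ext_powr y a"
  by (meson ext_powr_le_iff order.trans order_refl)

section \<open>Measures with a power-law radial part\<close>

text \<open>Closed tails at levels decreasing to \<open>r\<close> exhaust the open tail at
  \<open>r\<close>, and the power law is continuous at \<open>r > 0\<close>.\<close>

lemma emeasure_strict_tail: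
  fixes R :: "'a \<Rightarrow> ennreal" and S :: "'b measure"
  assumes "finite_measure S"
    and [measurable]: "R \<in> borel_measurable \<nu>"
    and \<Theta> [measurable]: "Measurable.pred \<nu> (\<lambda>x. \<Theta> x \<in> \<Lambda>)"
    and tail: "\<And>r. r > 0 \<Longrightarrow>
      emeasure \<nu> {x \<in> space \<nu>. R x \<ge> ennreal r \<and> \<Theta> x \<in> \<Lambda>} = ennreal (r powr - \<alpha>) * emeasure S \<Lambda>"
    and "r > 0"
  shows "emeasure \<nu> {x \<in> space \<nu>. R x > ennreal r \<and> \<Theta> x \<in> \<Lambda>} = ennreal (r powr - \<alpha>) * emeasure S \<Lambda>"
proof -
  interpret S: finite_measure S by fact
  \<comment> \<open>The levels lie strictly above \<open>r\<close>, so each closed tail at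
    \<open>q n\<close> is contained in the open tail at \<open>r\<close>.\<close>
  define q where "q n = r + inverse (real (Suc n))" for n
  define A where "A n = {x \<in> space \<nu>. R x \<ge> ennreal (q n) \<and> \<Theta> x \<in> \<Lambda>}" for n
  have q_gt: "r < q n" for n
    by (simp add: q_def)
  have q_lim: "q \<longlonglongrightarrow> r"
    unfolding q_def using tendsto_add[OF tendsto_const LIMSEQ_inverse_real_of_nat, of r] by simp
  have q_anti: "q n \<le> q m" if "m \<le> n" for m n
    using that by (simp add: q_def le_imp_inverse_le)
  have un: "(\<Union>n. A n) = {x \<in> space \<nu>. R x > ennreal r \<and> \<Theta> x \<in> \<Lambda>}"
  proof (intro equalityI subsetI)
    fix x assume "x \<in> (\<Union>n. A n)"
    moreover have "ennreal r < ennreal (q n)" for n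
      using q_gt[of n] \<open>r > 0\<close> by (simp add: ennreal_lessI)
    ultimately show "x \<in> {x \<in> space \<nu>. R x > ennreal r \<and> \<Theta> x \<in> \<Lambda>}"
      by (auto simp: A_def intro: less_le_trans)
  next
    fix x assume x: "x \<in> {x \<in> space \<nu>. R x > ennreal r \<and> \<Theta> x \<in> \<Lambda>}"
    have "(\<lambda>n. ennreal (q n)) \<longlonglongrightarrow> ennreal r"
      using q_lim by (rule tendsto_ennrealI)
    from order_tendstoD(2)[OF this, of "R x"] x obtain n where "ennreal (q n) < R x"
      by (auto simp: eventually_sequentially)
    with x show "x \<in> (\<Union>n. A n)"
      by (auto simp: A_def intro!: less_imp_le)
  qed
  have "(\<lambda>n. emeasure \<nu> (A n)) \<longlonglongrightarrow> emeasure \<nu> (\<Union>n. A n)"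
  proof (rule Lim_emeasure_incseq)
    have "A n \<in> sets \<nu>" for n
      unfolding A_def by measurable
    then show "range A \<subseteq> sets \<nu>"
      by auto
    show "incseq A"
      using q_anti by (auto simp: A_def incseq_def intro: order.trans[OF ennreal_leI])
  qed
  moreover have "(\<lambda>n. ennreal (q n powr - \<alpha>) * emeasure S \<Lambda>) \<longlonglongrightarrow> ennreal (r powr - \<alpha>) * emeasure S \<Lambda>"
    using q_lim \<open>r > 0\<close>
    \<comment> \<open>The constant factor moves to the front for
      \<open>ennreal_tendsto_cmult\<close>, which requires it to be finite; this is where finiteness
      of \<open>S\<close> enters.\<close>
    by (subst (1 2) mult.commute)
      (intro ennreal_tendsto_cmult tendsto_ennrealI tendsto_powr tendsto_const,
        auto simp: S.emeasure_eq_measure)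
  moreover have "emeasure \<nu> (A n) = ennreal (q n powr - \<alpha>) * emeasure S \<Lambda>" for n
    unfolding A_def using q_gt[of n] \<open>r > 0\<close> by (intro tail) auto
  ultimately show ?thesis
    unfolding un by (simp add: LIMSEQ_unique)
qed

text \<open>On the level set \<open>g = c\<close> with \<open>c > 0\<close> the condition is a
  strict radial tail at \<open>1 / c\<close>, whose mass is \<open>c\<close> to the power
  \<open>\<alpha>\<close> times the angular mass of the level set. Summing over the finitely many
  values gives the integral.\<close>

lemma emeasure_polar_simple:
  fixes R :: "'a \<Rightarrow> ennreal" and g :: "'b \<Rightarrow> ennreal"
  assumes "finite_measure S" "\<alpha> > 0"
    and R [measurable]: "R \<in> borel_measurable \<nu>"
    and \<Theta>: "\<And>\<Lambda>. \<Lambda> \<in> sets S \<Longrightarrow> Measurable.pred \<nu> (\<lambda>x. \<Theta> x \<in> \<Lambda>)"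
    and tail: "\<And>r \<Lambda>. r > 0 \<Longrightarrow> \<Lambda> \<in> sets S \<Longrightarrow>
      emeasure \<nu> {x \<in> space \<nu>. R x \<ge> ennreal r \<and> \<Theta> x \<in> \<Lambda>} = ennreal (r powr - \<alpha>) * emeasure S \<Lambda>"
    and g: "simple_function S g" and fin: "\<And>\<theta>. g \<theta> < \<infinity>"
  shows "emeasure \<nu> {x \<in> space \<nu>. \<Theta> x \<in> space S \<and> R x * g (\<Theta> x) > 1} =
    (\<integral>\<^sup>+\<theta>. ext_powr (g \<theta>) \<alpha> \<partial>S)"
proof -
  define \<Lambda> where "\<Lambda> c = g -` {c} \<inter> space S" for c
  define A where "A c = {x \<in> space \<nu>. \<Theta> x \<in> \<Lambda> c \<and> R x * c > 1}" for c
  have \<Lambda> [measurable]: "\<Lambda> c \<in> sets S" for c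
    unfolding \<Lambda>_def by (rule simple_functionD(2)[OF g])
  have [measurable]: "Measurable.pred \<nu> (\<lambda>x. \<Theta> x \<in> \<Lambda> c)" for c
    by (intro \<Theta> \<Lambda>)
  have A: "A c \<in> sets \<nu>" for c
    unfolding A_def by measurable
  have finim: "finite (g ` space S)"
    using g by (rule simple_functionD(1))
  have em: "emeasure \<nu> (A c) = ext_powr c \<alpha> * emeasure S (\<Lambda> c)" if "c \<in> g ` space S" for c
  \<comment> \<open>For \<open>c = 0\<close> both sides vanish: the product is \<open>0\<close> even
    where \<open>R\<close> is infinite, and \<open>0 powr \<alpha>\<close> is
    \<open>0\<close>.\<close>
  proof (cases "c = 0")
    case True
    then show ?thesis
      by (simp add: A_def ext_powr_def)
  next
    case False
    have "c < \<infinity>"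
      using that fin by auto
    with False obtain p where p: "p > 0" "c = ennreal p"
      by (cases c) (auto simp: less_le)
    have iff: "R x * c > 1 \<longleftrightarrow> R x > ennreal (1 / p)" for x
      using p by (cases "R x") (auto simp: ennreal_mult[symmetric] ennreal_mult_top ennreal_top_mult
          ennreal_less_iff field_simps simp flip: ennreal_1)
    have "A c = {x \<in> space \<nu>. R x > ennreal (1 / p) \<and> \<Theta> x \<in> \<Lambda> c}"
      unfolding A_def iff by auto
    then have "emeasure \<nu> (A c) = ennreal ((1 / p) powr - \<alpha>) * emeasure S (\<Lambda> c)"
      using p by (simp add: emeasure_strict_tail[OF assms(1) R \<Theta>[OF \<Lambda>] tail[OF _ \<Lambda>]])
    also have "(1 / p) powr - \<alpha> = p powr \<alpha>"
      using p by (simp add: powr_divide powr_minus field_simps)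
    finally show ?thesis
      using p by (simp add: ext_powr_ennreal)
  qed
  have "{x \<in> space \<nu>. \<Theta> x \<in> space S \<and> R x * g (\<Theta> x) > 1} = (\<Union>c\<in>g ` space S. A c)"
    by (auto simp: A_def \<Lambda>_def)
  then have "emeasure \<nu> {x \<in> space \<nu>. \<Theta> x \<in> space S \<and> R x * g (\<Theta> x) > 1} =
      (\<Sum>c\<in>g ` space S. emeasure \<nu> (A c))"
    using finim A
    by (simp only:) (intro sum_emeasure[symmetric], auto simp: disjoint_family_on_def A_def \<Lambda>_def)
  also have "\<dots> = (\<Sum>c\<in>g ` space S. ext_powr c \<alpha> * emeasure S (\<Lambda> c))"
    by (intro sum.cong refl em)
  also have "\<dots> = (\<Sum>c\<in>g ` space S. \<integral>\<^sup>+\<theta>. ext_powr c \<alpha> * indicator (\<Lambda> c) \<theta> \<partial>S)"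
    by (simp add: nn_integral_cmult_indicator)
  also have "\<dots> = (\<integral>\<^sup>+\<theta>. (\<Sum>c\<in>g ` space S. ext_powr c \<alpha> * indicator (\<Lambda> c) \<theta>) \<partial>S)"
    by (intro nn_integral_sum[symmetric]) auto
  also have "\<dots> = (\<integral>\<^sup>+\<theta>. ext_powr (g \<theta>) \<alpha> \<partial>S)"
  proof (rule nn_integral_cong)
    fix \<theta> assume "\<theta> \<in> space S"
    then have "(\<Sum>c\<in>g ` space S. ext_powr c \<alpha> * indicator (\<Lambda> c) \<theta>) =
        (\<Sum>c\<in>g ` space S. if c = g \<theta> then ext_powr c \<alpha> else 0)"
      by (intro sum.cong) (auto simp: \<Lambda>_def)
    with \<open>\<theta> \<in> space S\<close> show "(\<Sum>c\<in>g ` space S. ext_powr c \<alpha> * indicator (\<Lambda> c) \<theta>) = ext_powr (g \<theta>) \<alpha>"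
      using finim by (simp add: sum.delta)
  qed
  finally show ?thesis .
qed

text \<open>Finite-valued simple functions increase to \<open>f\<close>. The left side passes to the
  limit by continuity of measure from below, the right side by monotone convergence.\<close>

lemma emeasure_polar:
  fixes R :: "'a \<Rightarrow> ennreal" and f :: "'b \<Rightarrow> ennreal"
  assumes "finite_measure S" "\<alpha> > 0"
    and R [measurable]: "R \<in> borel_measurable \<nu>"
    and \<Theta>: "\<And>\<Lambda>. \<Lambda> \<in> sets S \<Longrightarrow> Measurable.pred \<nu> (\<lambda>x. \<Theta> x \<in> \<Lambda>)"
    and tail: "\<And>r \<Lambda>. r > 0 \<Longrightarrow> \<Lambda> \<in> sets S \<Longrightarrow>
      emeasure \<nu> {x \<in> space \<nu>. R x \<ge> ennreal r \<and> \<Theta> x \<in> \<Lambda>} = ennreal (r powr - \<alpha>) * emeasure S \<Lambda>"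
    and f: "f \<in> borel_measurable S"
  shows "emeasure \<nu> {x \<in> space \<nu>. \<Theta> x \<in> space S \<and> R x * f (\<Theta> x) > 1} =
    (\<integral>\<^sup>+\<theta>. ext_powr (f \<theta>) \<alpha> \<partial>S)"
proof -
  obtain F :: "nat \<Rightarrow> 'b \<Rightarrow> ennreal" where F: "incseq F" "\<And>i \<theta>. F i \<theta> < top"
      "\<And>i. simple_function S (F i)" "f = (SUP i. F i)"
    using borel_measurable_implies_simple_function_sequence[OF f] by metis
  define A where "A i = {x \<in> space \<nu>. \<Theta> x \<in> space S \<and> R x * F i (\<Theta> x) > 1}" for i
  have F_mono: "F i \<theta> \<le> F j \<theta>" if "i \<le> j" for i j \<theta>
    using F(1) that by (auto simp: incseq_def le_fun_def)
  \<comment> \<open>A supremum exceeds 1 exactly when one of its members does; with a non-strict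
    inequality this equality of sets could fail.\<close>
  have "{x \<in> space \<nu>. \<Theta> x \<in> space S \<and> R x * f (\<Theta> x) > 1} = (\<Union>i. A i)"
    unfolding A_def F(4) SUP_apply SUP_mult_left_ennreal less_SUP_iff by blast
  moreover have "(SUP i. emeasure \<nu> (A i)) = emeasure \<nu> (\<Union>i. A i)"
  proof (rule SUP_emeasure_incseq)
    have "A i \<in> sets \<nu>" for i
    proof -
      \<comment> \<open>\<open>\<Theta>\<close> may take values outside \<open>space S\<close>, so
        it need not be a measurable map into \<open>S\<close>; only preimages of sets of
        \<open>S\<close> are available, here those of the level sets of \<open>F i\<close>.\<close>
      have "A i = (\<Union>c\<in>F i ` space S. {x \<in> space \<nu>. \<Theta> x \<in> F i -` {c} \<inter> space S \<and> R x * c > 1})"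
        by (auto simp: A_def)
      also have "\<dots> \<in> sets \<nu>"
      proof (rule sets.finite_UN)
        fix c
        have [measurable]: "Measurable.pred \<nu> (\<lambda>x. \<Theta> x \<in> F i -` {c} \<inter> space S)"
          by (intro \<Theta> simple_functionD(2)[OF F(3)])
        show "{x \<in> space \<nu>. \<Theta> x \<in> F i -` {c} \<inter> space S \<and> R x * c > 1} \<in> sets \<nu>"
          by measurable
      qed (rule simple_functionD(1)[OF F(3)])
      finally show ?thesis .
    qed
    then show "range A \<subseteq> sets \<nu>"
      by auto
    show "incseq A"
      by (auto simp: A_def incseq_def intro: less_le_trans[OF _ mult_left_mono[OF F_mono]])
  qed
  moreover have "emeasure \<nu> (A i) = (\<integral>\<^sup>+\<theta>. ext_powr (F i \<theta>) \<alpha> \<partial>S)" for i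
    unfolding A_def
    by (rule emeasure_polar_simple[OF assms(1,2) R \<Theta> tail F(3)]) (use F(2) in auto)
  moreover have "(\<integral>\<^sup>+\<theta>. ext_powr (f \<theta>) \<alpha> \<partial>S) = (SUP i. \<integral>\<^sup>+\<theta>. ext_powr (F i \<theta>) \<alpha> \<partial>S)"
    unfolding F(4) SUP_apply ext_powr_SUP[OF \<open>\<alpha> > 0\<close>]
  proof (rule nn_integral_monotone_convergence_SUP)
    show "incseq (\<lambda>i \<theta>. ext_powr (F i \<theta>) \<alpha>)"
      by (auto simp: incseq_def le_fun_def intro!: ext_powr_mono[OF \<open>\<alpha> > 0\<close>] F_mono)
    show "(\<lambda>\<theta>. ext_powr (F i \<theta>) \<alpha>) \<in> borel_measurable S" for i
      by (intro borel_measurable_simple_function simple_function_compose1[OF F(3)])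
  qed
  ultimately show ?thesis
    by simp
qed

section \<open>Order statistics\<close>

text \<open>In the decreasing arrangement the positions with entry at least \<open>r\<close> form an
  initial segment, which contains the zero-based position \<open>l - 1\<close> exactly when it has
  at least \<open>l\<close> elements. Counting then replaces sorted lists in all later
  arguments.\<close>

lemma le_ord_stat_iff:
  fixes x :: "'d::finite \<Rightarrow> 'b::linorder"
  assumes "1 \<le> l" "l \<le> CARD('d)"
  shows "r \<le> ord_stat l x \<longleftrightarrow> l \<le> card {i. r \<le> x i}"
proof -
  define xs where "xs = rev (sorted_list_of_multiset (image_mset x (mset_set UNIV)))"
  define K where "K = {k. k < length xs \<and> r \<le> xs ! k}"
  have mset_xs: "mset xs = image_mset x (mset_set UNIV)"
    by (simp add: xs_def)
  have len: "length xs = CARD('d)"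
    using arg_cong[OF mset_xs, of size] by simp
  have "card {i. r \<le> x i} = size (filter_mset ((\<le>) r) (mset xs))"
    by (simp add: mset_xs filter_mset_image_mset)
  also have "\<dots> = card K"
    by (simp add: K_def length_filter_conv_card flip: mset_filter)
  finally have card: "card {i. r \<le> x i} = card K" .
  have "sorted (rev xs)"
    by (simp add: xs_def)
  then have desc: "xs ! j \<le> xs ! i" if "i \<le> j" "j < length xs" for i j
    using that by (intro sorted_rev_nth_mono)
  have finK: "finite K"
    by (simp add: K_def)
  have ord: "ord_stat l x = xs ! (l - 1)"
    by (simp add: ord_stat_def xs_def)
  show ?thesis
    unfolding card ord
  proof
    assume "r \<le> xs ! (l - 1)"
    then have "{..<l} \<subseteq> K"
      using assms len by (auto simp: K_def intro: order.trans[OF _ desc])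
    from card_mono[OF finK this] show "l \<le> card K"
      by simp
  next
    assume "l \<le> card K"
    show "r \<le> xs ! (l - 1)"
    proof (rule ccontr)
      assume "\<not> r \<le> xs ! (l - 1)"
      \<comment> \<open>Position \<open>l - 1\<close> fails, so by descent all of \<open>K\<close>
        lies before it, which leaves room for at most \<open>l - 1\<close> elements.\<close>
      then have "k < l - 1" if "k \<in> K" for k
        using that desc[of "l - 1" k] by (auto simp: K_def not_le[symmetric] dest: order.trans)
      then have "K \<subseteq> {..<l - 1}"
        by auto
      from card_mono[OF _ this] \<open>l \<le> card K\<close> assms show False
        by simp
    qed
  qed
qed

text \<open>By the counting criterion a superlevel set is a finite union, over the index sets of
  size \<open>l\<close>, of finite intersections of coordinate superlevel sets.\<close>

lemma borel_measurable_ord_stat: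
  assumes "1 \<le> l" "l \<le> CARD('d::finite)"
  shows "(ord_stat l :: ('d \<Rightarrow> ennreal) \<Rightarrow> ennreal) \<in> borel_measurable borel"
proof (rule borel_measurableI_ge)
  fix r :: ennreal
  have [measurable]: "(\<lambda>x::'d \<Rightarrow> ennreal. x i) \<in> borel_measurable borel" for i
    by (rule borel_measurable_continuous_onI) simp
  have "l \<le> card {i. r \<le> x i} \<longleftrightarrow> (\<exists>I. card I = l \<and> (\<forall>i\<in>I. r \<le> x i))" for x :: "'d \<Rightarrow> ennreal"
  proof
    assume "l \<le> card {i. r \<le> x i}"
    from obtain_subset_with_card_n[OF this] show "\<exists>I. card I = l \<and> (\<forall>i\<in>I. r \<le> x i)"
      by blast
  next
    assume "\<exists>I. card I = l \<and> (\<forall>i\<in>I. r \<le> x i)"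
    then show "l \<le> card {i. r \<le> x i}"
      by (auto intro!: card_mono)
  qed
  then have "{x. r \<le> ord_stat l x} = {x :: 'd \<Rightarrow> ennreal. \<exists>I. card I = l \<and> (\<forall>i\<in>I. r \<le> x i)}"
    by (simp add: le_ord_stat_iff[OF assms])
  also have "\<dots> = (\<Union>I\<in>{I. card I = l}. \<Inter>i\<in>I. {x. r \<le> x i})"
    by auto
  also have "\<dots> \<in> sets borel"
  proof (intro sets.finite_UN)
    fix I :: "'d set"
    assume "I \<in> {I. card I = l}"
    \<comment> \<open>The index set is nonempty because \<open>1 \<le> l\<close>, as
      \<open>sets.finite_INT\<close> requires.\<close>
    then show "(\<Inter>i\<in>I. {x :: 'd \<Rightarrow> ennreal. r \<le> x i}) \<in> sets borel"
      using assms by (intro sets.finite_INT) auto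
  qed simp
  finally show "{x \<in> space borel. r \<le> ord_stat l x} \<in> sets (borel :: ('d \<Rightarrow> ennreal) measure)"
    by simp
qed

lemma ennreal_le_divide_iff:
  fixes a c r :: ennreal
  assumes "0 < c" "c < \<infinity>"
  shows "r \<le> a / c \<longleftrightarrow> r * c \<le> a"
proof -
  have c: "c \<noteq> 0" "c \<noteq> top"
    using assms by auto
  show ?thesis
  proof
    assume "r \<le> a / c"
    then have "r * c \<le> a / c * c"
      by (rule mult_right_mono) simp
    also have "a / c * c = a"
      using c by (simp add: ennreal_divide_times less_top)
    finally show "r * c \<le> a" .
  next
    assume "r * c \<le> a"
    then have "r * c / c \<le> a / c"
      by (rule divide_right_mono_ennreal)
    then show "r \<le> a / c"
      using c by (simp add: ennreal_mult_divide_eq)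
  qed
qed

text \<open>Dividing by \<open>c\<close> turns the threshold \<open>r\<close> into
  \<open>r * c\<close> on every component and on the \<open>l\<close>-th largest one alike, so the
  counting criterion is the same for both sides.\<close>

lemma ord_stat_divide:
  fixes x :: "'d::finite \<Rightarrow> ennreal"
  assumes "1 \<le> l" "l \<le> CARD('d)" "0 < c" "c < \<infinity>"
  shows "ord_stat l (\<lambda>i. x i / c) = ord_stat l x / c"
proof -
  have "r \<le> ord_stat l (\<lambda>i. x i / c) \<longleftrightarrow> r \<le> ord_stat l x / c" for r
    using assms by (simp add: le_ord_stat_iff ennreal_le_divide_iff)
  \<comment> \<open>Two elements with the same lower bounds coincide.\<close>
  then show ?thesis
    by (meson order.antisym order_refl)
qed

section \<open>Norms on the extended orthant\<close>

text \<open>Homogeneity and the triangle inequality make \<open>N\<close> convex, and a real-valued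
  convex function on a Euclidean space is continuous.\<close>

lemma is_norm_continuous:
  fixes N :: "'v::euclidean_space \<Rightarrow> real"
  assumes "is_norm N"
  shows "continuous_on UNIV N"
proof (rule convex_on_continuous)
  show "convex_on UNIV N"
  proof (rule convex_onI)
    fix t :: real and x y :: 'v
    assume "0 < t" "t < 1"
    have "N ((1 - t) *\<^sub>R x + t *\<^sub>R y) \<le> N ((1 - t) *\<^sub>R x) + N (t *\<^sub>R y)"
      using assms unfolding is_norm_def by blast
    also have "\<dots> = (1 - t) * N x + t * N y"
      using assms \<open>0 < t\<close> \<open>t < 1\<close> by (simp add: is_norm_def)
    finally show "N ((1 - t) *\<^sub>R x + t *\<^sub>R y) \<le> (1 - t) * N x + t * N y" .
  qed simp
qed simp

lemma borel_measurable_ext_norm: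
  fixes N :: "real ^ 'd::finite \<Rightarrow> real"
  assumes "is_norm N"
  shows "ext_norm N \<in> borel_measurable borel"
proof -
  have [measurable]: "(\<lambda>x::'d \<Rightarrow> ennreal. x i) \<in> borel_measurable borel" for i
    by (rule borel_measurable_continuous_onI) simp
  have "(\<lambda>x::'d \<Rightarrow> ennreal. (\<chi> i. enn2real (x i)) :: real ^ 'd) \<in> borel_measurable borel"
    by (rule borel_measurable_euclidean_space[THEN iffD2])
      (auto simp: Basis_vec_def inner_axis)
  from measurable_compose[OF this borel_measurable_continuous_onI[OF is_norm_continuous[OF assms]]]
  have [measurable]: "(\<lambda>x::'d \<Rightarrow> ennreal. N (\<chi> i. enn2real (x i))) \<in> borel_measurable borel" .
  show ?thesis
    unfolding ext_norm_def by measurable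
qed

text \<open>With \<open>c\<close> the radius of \<open>x\<close>, this identifies radius times norm
  of the angle with the norm of the point.\<close>

lemma ext_norm_divide:
  fixes x :: "'d::finite \<Rightarrow> ennreal"
  assumes "is_norm N" "0 < c" "c < \<infinity>"
  shows "c * ext_norm N (\<lambda>i. x i / c) = ext_norm N x"
proof -
  obtain p where p: "p > 0" "c = ennreal p"
    using assms by (cases c) (auto simp: less_le)
  \<comment> \<open>Division by a positive finite \<open>c\<close> neither creates nor removes
    infinite components, so both sides fall into the same branch of \<open>ext_norm\<close>.\<close>
  have inf: "x i / c = \<infinity> \<longleftrightarrow> x i = \<infinity>" for i
    using assms by (auto simp: ennreal_divide_eq_top_iff ennreal_top_divide)
  show ?thesis
  proof (cases "\<exists>i. x i = \<infinity>")
    case True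
    then show ?thesis
      unfolding ext_norm_def inf using assms by (simp add: ennreal_mult_top)
  next
    case False
    have "enn2real (x i / c) = (1 / p) * enn2real (x i)" for i
      using False p by (cases "x i") (auto simp: divide_ennreal)
    then have "(\<chi> i. enn2real (x i / c)) = (1 / p) *\<^sub>R (\<chi> i. enn2real (x i))"
      by (simp add: vec_eq_iff)
    then have "p * N (\<chi> i. enn2real (x i / c)) = N (\<chi> i. enn2real (x i))"
      using assms(1) p by (simp add: is_norm_def)
    with False p assms(1) show ?thesis
      unfolding ext_norm_def inf by (simp add: is_norm_def flip: ennreal_mult)
  qed
qed

section \<open>The hidden angular measure\<close>

lemma polar_measurable:
  assumes "1 \<le> l" "l \<le> CARD('d::finite)"
  shows "(\<lambda>(x :: 'd \<Rightarrow> ennreal) i. x i / ord_stat l x) \<in> borel_measurable borel"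
proof (rule measurable_coordinatewise_then_product)
  fix i :: 'd
  have [measurable]: "(\<lambda>x::'d \<Rightarrow> ennreal. x i) \<in> borel_measurable borel"
    by (rule borel_measurable_continuous_onI) simp
  note [measurable] = borel_measurable_ord_stat[OF assms]
  show "(\<lambda>x::'d \<Rightarrow> ennreal. x i / ord_stat l x) \<in> borel_measurable borel"
    by measurable
qed

text \<open>\<open>emeasure_polar\<close> applies with radius \<open>ord_stat l\<close>, but it sees
  only points of finite radius. The normalization of \<open>\<nu>\<close> shows that the remaining
  points form a null set.\<close>

lemma emeasure_ext_norm_eq_integral:
  fixes \<nu> S :: "('d::finite \<Rightarrow> ennreal) measure"
  assumes l: "1 \<le> l" "l \<le> CARD('d)" and "\<alpha> > 0"
    and sets_\<nu>: "sets \<nu> = sets (restrict_space borel (ext_cone l))"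
    and S: "hidden_angular_measure l \<nu> \<alpha> S"
    and one: "emeasure \<nu> (aleph l) = 1"
    and N: "is_norm N"
  shows "emeasure \<nu> {x \<in> ext_cone l. ext_norm N x > 1} = (\<integral>\<^sup>+\<theta>. ext_powr (ext_norm N \<theta>) \<alpha> \<partial>S)"
proof -
  define \<Theta> where "\<Theta> = (\<lambda>(x :: 'd \<Rightarrow> ennreal) i. x i / ord_stat l x)"
  interpret S: prob_space S
    using S by (simp add: hidden_angular_measure_def)
  have sets_S: "sets S = sets (restrict_space borel (delta_aleph l))"
    using S by (simp add: hidden_angular_measure_def)
  have space_\<nu>: "space \<nu> = ext_cone l"
    using sets_eq_imp_space_eq[OF sets_\<nu>] by (simp add: space_restrict_space)
  have space_S: "space S = delta_aleph l"
    using sets_eq_imp_space_eq[OF sets_S] by (simp add: space_restrict_space)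
  have from_borel: "f \<in> measurable \<nu> K" if "f \<in> measurable borel K" for f and K :: "'k measure"
    using measurable_restrict_space1[OF that] measurable_cong_sets[OF sets_\<nu> refl] by blast
  note [measurable] = from_borel[OF borel_measurable_ord_stat[OF l]]
    from_borel[OF borel_measurable_ext_norm[OF N]]
  have \<Theta> [measurable]: "\<Theta> \<in> borel_measurable \<nu>"
    unfolding \<Theta>_def by (rule from_borel[OF polar_measurable[OF l]])
  have "ext_cone l \<in> sets (borel :: ('d \<Rightarrow> ennreal) measure)"
    "delta_aleph l \<in> sets (borel :: ('d \<Rightarrow> ennreal) measure)"
  proof -
    note [measurable] = borel_measurable_ord_stat[OF l]
    have "{x \<in> space borel. 0 < ord_stat l x} \<in> sets (borel :: ('d \<Rightarrow> ennreal) measure)"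
      "{x \<in> space borel. 0 < ord_stat l x \<and> ord_stat l x = 1} \<in> sets (borel :: ('d \<Rightarrow> ennreal) measure)"
      by measurable
    then show "ext_cone l \<in> sets (borel :: ('d \<Rightarrow> ennreal) measure)"
      "delta_aleph l \<in> sets (borel :: ('d \<Rightarrow> ennreal) measure)"
      by (simp_all add: ext_cone_def delta_aleph_def)
  qed
  \<comment> \<open>Since \<open>delta_aleph l\<close> is Borel, the sets of \<open>S\<close> are
    Borel in the whole space and can be pulled back along \<open>\<Theta>\<close>.\<close>
  then have pred: "Measurable.pred \<nu> (\<lambda>x. \<Theta> x \<in> \<Lambda>)" if "\<Lambda> \<in> sets S" for \<Lambda>
  proof -
    have [measurable]: "\<Lambda> \<in> sets borel"
      using that \<open>delta_aleph l \<in> _\<close> by (auto simp: sets_S sets_restrict_space)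
    show ?thesis
      by measurable
  qed
  have tail: "emeasure \<nu> {x \<in> space \<nu>. ord_stat l x \<ge> ennreal r \<and> \<Theta> x \<in> \<Lambda>} =
      ennreal (r powr - \<alpha>) * emeasure S \<Lambda>" if "r > 0" "\<Lambda> \<in> sets S" for r \<Lambda>
    using S that by (simp add: hidden_angular_measure_def space_\<nu> \<Theta>_def)
  have in_S_iff: "\<Theta> x \<in> space S \<longleftrightarrow> ord_stat l x < \<infinity>" if "x \<in> ext_cone l" for x
  proof (cases "ord_stat l x < \<infinity>")
    case True
    with that l have "ord_stat l (\<Theta> x) = 1"
      unfolding \<Theta>_def by (subst ord_stat_divide) (auto simp: ext_cone_def ennreal_divide_self)
    with True show ?thesis
      by (simp add: space_S delta_aleph_def ext_cone_def)
  next
    case False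
    \<comment> \<open>Division by infinity gives \<open>0\<close> in \<open>ennreal\<close>, even
      for an infinite numerator. The zero vector has no component reaching 1, so its count is
      \<open>0\<close>, below \<open>l\<close>.\<close>
    then have "\<Theta> x = (\<lambda>i. 0)"
      by (simp add: \<Theta>_def top.not_eq_extremum[symmetric])
    moreover have "ord_stat l (\<lambda>i::'d. 0 :: ennreal) \<noteq> 1"
    proof
      assume "ord_stat l (\<lambda>i::'d. 0 :: ennreal) = 1"
      then show False
        using le_ord_stat_iff[OF l, of "1::ennreal" "\<lambda>i. 0"] l by simp
    qed
    ultimately show ?thesis
      using False by (simp add: space_S delta_aleph_def)
  qed
  have null: "emeasure \<nu> {x \<in> space \<nu>. \<Theta> x \<notin> space S} = 0"
  proof -
    note [measurable] = pred[OF sets.top]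
    \<comment> \<open>Points of infinite radius all lie in \<open>aleph l\<close>. The tail formula
      at radius 1 over all angles already gives \<open>?B\<close> the full mass 1 of
      \<open>aleph l\<close>, and cancelling this finite mass leaves nothing for
      \<open>?I\<close>.\<close>
    let ?B = "{x \<in> space \<nu>. ord_stat l x \<ge> ennreal 1 \<and> \<Theta> x \<in> space S}"
    let ?I = "{x \<in> space \<nu>. \<Theta> x \<notin> space S}"
    have "aleph l = ?B \<union> ?I"
      by (auto simp: aleph_def space_\<nu> in_S_iff not_less top_unique)
    then have "emeasure \<nu> ?B + emeasure \<nu> ?I = emeasure \<nu> (aleph l)"
      by (simp only:) (rule plus_emeasure, auto)
    moreover have "emeasure \<nu> ?B = 1"
      by (subst tail) (auto simp: S.emeasure_space_1)
    ultimately have "1 + emeasure \<nu> ?I = 1 + 0"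
      using one by simp
    then show ?thesis
      unfolding ennreal_add_left_cancel by simp
  qed
  have "emeasure \<nu> {x \<in> ext_cone l. ext_norm N x > 1} =
      emeasure \<nu> {x \<in> space \<nu>. \<Theta> x \<in> space S \<and> ord_stat l x * ext_norm N (\<Theta> x) > 1}"
  proof -
    note [measurable] = pred[OF sets.top]
    \<comment> \<open>Where the radius is finite, homogeneity of the norm turns the polar condition
      into \<open>ext_norm N x > 1\<close>; the two sets differ only inside the null set.\<close>
    have "{x \<in> space \<nu>. \<Theta> x \<in> space S \<and> ord_stat l x * ext_norm N (\<Theta> x) > 1} =
        {x \<in> ext_cone l. ext_norm N x > 1} - {x \<in> space \<nu>. \<Theta> x \<notin> space S}"
      using ext_norm_divide[OF N] in_S_iff by (auto simp: space_\<nu> \<Theta>_def ext_cone_def)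
    moreover have "{x \<in> space \<nu>. ext_norm N x > 1} \<in> sets \<nu>"
      by measurable
    moreover have "{x \<in> space \<nu>. \<Theta> x \<notin> space S} \<in> sets \<nu>"
      by measurable
    ultimately show ?thesis
      using null by (simp add: emeasure_Diff_null_set null_sets_def space_\<nu>)
  qed
  also have "\<dots> = (\<integral>\<^sup>+\<theta>. ext_powr (ext_norm N \<theta>) \<alpha> \<partial>S)"
  proof (rule emeasure_polar)
    show "ext_norm N \<in> borel_measurable S"
      using measurable_restrict_space1[OF borel_measurable_ext_norm[OF N]]
        measurable_cong_sets[OF sets_S refl] by blast
  qed (use tail pred \<open>\<alpha> > 0\<close> S.finite_measure_axioms in auto)
  finally show ?thesis .
qed

theorem theorem5p1:
  fixes M :: "'a measure"
    and Z :: "'a \<Rightarrow> real ^ 'd::finite"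
    and l :: nat
    and b :: "nat \<Rightarrow> real \<Rightarrow> real"
    and \<nu> :: "nat \<Rightarrow> ('d \<Rightarrow> ennreal) measure"
    and \<alpha> :: real
    and S :: "('d \<Rightarrow> ennreal) measure"
    and N :: "real ^ 'd \<Rightarrow> real"
  assumes "2 \<le> l" and "l \<le> CARD('d)"
    and "prob_space M" and "Z \<in> borel_measurable M"
    and "\<And>\<omega> i. \<omega> \<in> space M \<Longrightarrow> 0 \<le> Z \<omega> $ i"
    and "hidden_regular_variation M Z l b \<nu>"
    and "\<alpha> > 0" and "homogeneity_index (\<nu> l) \<alpha>"
    and "hidden_angular_measure l (\<nu> l) \<alpha> S"
    and "emeasure (\<nu> l) {x \<in> ext_cone l. ord_stat l x \<ge> 1} = 1"
    and "is_norm N"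
  shows "emeasure (\<nu> l) {x \<in> ext_cone l. ext_norm N x > 1} < \<infinity> \<longleftrightarrow>
         (\<integral>\<^sup>+ \<theta>. ext_powr (ext_norm N \<theta>) \<alpha> \<partial>S) < \<infinity>"
proof -
  \<comment> \<open>In the standard and the non-standard case alike, regular variation on
    \<open>ext_cone l\<close> fixes the sigma-algebra of \<open>\<nu> l\<close>.\<close>
  have "radon_measure_on (ext_cone l) (\<nu> l)"
    using \<open>hidden_regular_variation M Z l b \<nu>\<close>
    by (auto simp: hidden_regular_variation_def hrv_standard_def regularly_varying_def)
  then have "emeasure (\<nu> l) {x \<in> ext_cone l. ext_norm N x > 1} =
      (\<integral>\<^sup>+ \<theta>. ext_powr (ext_norm N \<theta>) \<alpha> \<partial>S)"
    using assms
    by (intro emeasure_ext_norm_eq_integral) (auto simp: radon_measure_on_def aleph_def)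
  then show ?thesis
    by simp
qed

end
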